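(* Non-real bichromatic roots can have arbitrarily large modulus: for every $M>0$ there is a non-real bichromatic root $z$ with $|z|>M$.
   Context: All graphs are finite and simple. A $2$-edge-coloured graph is a triple $G=(\Gamma,R,B)$ with $R,B\subseteq E(\Gamma)$, $R\cap B=\emptyset$, $R\cup B=E(\Gamma)$ (red and blue edges); it is bichromatic if $R\ne\emptyset$ and $B\ne\emptyset$. A $k$-colouring of $G$ is a proper vertex colouring $c:V(\Gamma)\to\{1,\dots,k\}$ of $\Gamma$ such that for every $ux\in R$ and $vy\in B$ (either endpoint may play the role of $u$, resp. $v$), $c(u)=c(v)$ implies $c(x)\ne c(y)$. $P(G,\lambda)$ is the polynomial whose value at each non-negative integer $k$ is the number of $k$-colourings of $G$. A bichromatic root is a complex number that is a root of $P(G,\lambda)$ for some bichromatic $2$-edge-coloured graph $G$. *)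

theory Defs
  imports Complex_Main "HOL-Library.FuncSet" "HOL-Computational_Algebra.Polynomial"
begin

record 'a two_edge_coloured_graph =
  verts :: "'a set"
  edges :: "'a set set"
  red :: "'a set set"
  blue :: "'a set set"

definition two_edge_coloured :: "'a two_edge_coloured_graph \<Rightarrow> bool" where
  "two_edge_coloured G \<longleftrightarrow>
     finite (verts G) \<and> (\<forall>e\<in>edges G. e \<subseteq> verts G \<and> card e = 2) \<and>
     red G \<subseteq> edges G \<and> blue G \<subseteq> edges G \<and>
     red G \<inter> blue G = {} \<and> red G \<union> blue G = edges G"

definition bichromatic :: "'a two_edge_coloured_graph \<Rightarrow> bool" where
  "bichromatic G \<longleftrightarrow> two_edge_coloured G \<and> red G \<noteq> {} \<and> blue G \<noteq> {}"

text \<open>Since \<open>{u, x} = {x, u}\<close>, quantifying over \<open>u x v y\<close> lets either endpoint of each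
  edge play the role of \<open>u\<close>, resp. \<open>v\<close>. Colourings are extensional functions on the vertex
  set, so that they can be counted.\<close>

definition colourings :: "'a two_edge_coloured_graph \<Rightarrow> nat \<Rightarrow> ('a \<Rightarrow> nat) set" where
  "colourings G k =
     {c \<in> verts G \<rightarrow>\<^sub>E {1..k}.
        (\<forall>u v. {u, v} \<in> edges G \<longrightarrow> c u \<noteq> c v) \<and>
        (\<forall>u x v y. {u, x} \<in> red G \<longrightarrow> {v, y} \<in> blue G \<longrightarrow> c u = c v \<longrightarrow> c x \<noteq> c y)}"

definition chromatic_poly :: "'a two_edge_coloured_graph \<Rightarrow> complex poly" where
  "chromatic_poly G = (THE p. \<forall>k::nat. poly p (of_nat k) = of_nat (card (colourings G k)))"

text \<open>The description operator is justified by the existence and uniqueness of such a polynomial: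
  the colourings with colour set \<open>A\<close> are counted by a number depending only on \<open>card A\<close>.\<close>

lemma poly_eqI_nat:
  fixes p q :: "complex poly"
  assumes "\<And>k::nat. poly p (of_nat k) = poly q (of_nat k)"
  shows "p = q"
proof (rule ccontr)
  assume "p \<noteq> q"
  then have "finite {x. poly (p - q) x = 0}"
    by (intro poly_roots_finite) simp
  moreover have "range (of_nat :: nat \<Rightarrow> complex) \<subseteq> {x. poly (p - q) x = 0}"
    using assms by auto
  ultimately show False
    using infinite_UNIV_char_0 finite_subset range_inj_infinite[OF inj_of_nat] by blast
qed

definition onto_colourings :: "'a two_edge_coloured_graph \<Rightarrow> nat set \<Rightarrow> ('a \<Rightarrow> nat) set" where
  "onto_colourings G A =
     {c \<in> extensional (verts G). c ` verts G = A \<and>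
        (\<forall>u v. {u, v} \<in> edges G \<longrightarrow> c u \<noteq> c v) \<and>
        (\<forall>u x v y. {u, x} \<in> red G \<longrightarrow> {v, y} \<in> blue G \<longrightarrow> c u = c v \<longrightarrow> c x \<noteq> c y)}"

lemma onto_colourings_relabel:
  assumes G: "two_edge_coloured G" and g: "bij_betw g A B" and c: "c \<in> onto_colourings G A"
  shows "restrict (g \<circ> c) (verts G) \<in> onto_colourings G B"
proof -
  have E: "\<And>u v. {u, v} \<in> edges G \<Longrightarrow> u \<in> verts G \<and> v \<in> verts G"
    and RB: "red G \<subseteq> edges G" "blue G \<subseteq> edges G"
    using G unfolding two_edge_coloured_def by auto
  have im: "c ` verts G = A" using c by (simp add: onto_colourings_def)
  have inj: "\<And>u v. u \<in> verts G \<Longrightarrow> v \<in> verts G \<Longrightarrow> g (c u) = g (c v) \<longleftrightarrow> c u = c v"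
    using g im unfolding bij_betw_def by (metis imageI inj_on_eq_iff)
  have "restrict (g \<circ> c) (verts G) ` verts G = B"
    using g im by (auto simp: bij_betw_def)
  moreover have "restrict (g \<circ> c) (verts G) u \<noteq> restrict (g \<circ> c) (verts G) v"
    if "{u, v} \<in> edges G" for u v
    using that c E[OF that] inj by (simp add: onto_colourings_def)
  moreover have "restrict (g \<circ> c) (verts G) x \<noteq> restrict (g \<circ> c) (verts G) y"
    if r: "{u, x} \<in> red G" and b: "{v, y} \<in> blue G"
      and eq: "restrict (g \<circ> c) (verts G) u = restrict (g \<circ> c) (verts G) v" for u x v y
  proof -
    have V: "u \<in> verts G" "x \<in> verts G" "v \<in> verts G" "y \<in> verts G"
      using E r b RB by blast+
    then have "c u = c v" using eq inj by simp
    then have "c x \<noteq> c y" using c r b unfolding onto_colourings_def by blast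
    then show ?thesis using V inj by simp
  qed
  ultimately show ?thesis unfolding onto_colourings_def by blast
qed

lemma card_onto_colourings:
  assumes G: "two_edge_coloured G" and A: "finite A"
  shows "card (onto_colourings G A) = card (onto_colourings G {1..card A})"
proof -
  obtain g where g: "bij_betw g A {1..card A}"
    using A finite_same_card_bij[of A "{1..card A}"] by auto
  let ?h = "inv_into A g"
  have h: "bij_betw ?h {1..card A} A" by (rule bij_betw_inv_into[OF g])
  have 1: "restrict (?h \<circ> restrict (g \<circ> c) (verts G)) (verts G) = c"
    if "c \<in> onto_colourings G A" for c
    using that bij_betw_inv_into_left[OF g]
    by (intro extensionalityI[of _ "verts G"]) (auto simp: onto_colourings_def)
  have 2: "restrict (g \<circ> restrict (?h \<circ> c) (verts G)) (verts G) = c"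
    if "c \<in> onto_colourings G {1..card A}" for c
  proof (rule extensionalityI[of _ "verts G"])
    fix v assume "v \<in> verts G"
    moreover from this have "c v \<in> {1..card A}" using that by (auto simp: onto_colourings_def)
    ultimately show "restrict (g \<circ> restrict (?h \<circ> c) (verts G)) (verts G) v = c v"
      using bij_betw_inv_into_right[OF g] by simp
  qed (use that in \<open>auto simp: onto_colourings_def\<close>)
  have "bij_betw (\<lambda>c. restrict (g \<circ> c) (verts G))
          (onto_colourings G A) (onto_colourings G {1..card A})"
    by (rule bij_betw_byWitness[where f' = "\<lambda>c. restrict (?h \<circ> c) (verts G)"])
       (use 1 2 onto_colourings_relabel[OF G g] onto_colourings_relabel[OF G h] in auto)
  then show ?thesis by (rule bij_betw_same_card)
qed

lemma finite_onto_colourings: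
  assumes "two_edge_coloured G" "finite A"
  shows "finite (onto_colourings G A)"
proof (rule finite_subset)
  show "onto_colourings G A \<subseteq> verts G \<rightarrow>\<^sub>E A"
    by (auto simp: onto_colourings_def PiE_def)
  show "finite (verts G \<rightarrow>\<^sub>E A)"
    using assms by (intro finite_PiE) (auto simp: two_edge_coloured_def)
qed

lemma card_colourings:
  assumes G: "two_edge_coloured G"
  shows "card (colourings G k) =
    (\<Sum>j\<le>card (verts G). card (onto_colourings G {1..j}) * (k choose j))"
proof -
  let ?n = "card (verts G)"
  let ?F = "\<lambda>A. card (onto_colourings G A)"
  have V: "finite (verts G)" using G by (simp add: two_edge_coloured_def)
  have z: "?F A = 0" if "finite A" "card A > ?n" for A
  proof -
    have "onto_colourings G A = {}"
      using that card_image_le[OF V] unfolding onto_colourings_def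
      by (metis (mono_tags, lifting) mem_Collect_eq equals0I leD)
    then show ?thesis by simp
  qed
  have "colourings G k = (\<Union>A\<in>Pow {1..k}. onto_colourings G A)"
    unfolding colourings_def onto_colourings_def PiE_def Pi_def by auto
  also have "card \<dots> = (\<Sum>A\<in>Pow {1..k}. ?F A)"
  proof (rule card_UN_disjoint)
    show "\<forall>A\<in>Pow {1..k}. finite (onto_colourings G A)"
      using finite_onto_colourings[OF G] finite_subset[of _ "{1..k}"] by blast
  qed (auto simp: onto_colourings_def)
  also have "\<dots> = (\<Sum>A\<in>{A\<in>Pow {1..k}. card A \<le> ?n}. ?F A)"
  proof (rule sum.mono_neutral_right)
    show "\<forall>A\<in>Pow {1..k} - {A\<in>Pow {1..k}. card A \<le> ?n}. ?F A = 0"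
      by (intro ballI z) (auto dest: finite_subset)
  qed auto
  also have "\<dots> = (\<Sum>j\<le>?n. \<Sum>A\<in>{A\<in>{A\<in>Pow {1..k}. card A \<le> ?n}. card A = j}. ?F A)"
    by (intro sum.group[symmetric]) auto
  also have "\<dots> = (\<Sum>j\<le>?n. ?F {1..j} * (k choose j))"
  proof (rule sum.cong[OF refl])
    fix j assume j: "j \<in> {..?n}"
    have "(\<Sum>A\<in>{A\<in>{A\<in>Pow {1..k}. card A \<le> ?n}. card A = j}. ?F A) =
          (\<Sum>A\<in>{A. A \<subseteq> {1..k} \<and> card A = j}. ?F {1..j})"
    proof (rule sum.cong)
      show "{A\<in>{A\<in>Pow {1..k}. card A \<le> ?n}. card A = j} = {A. A \<subseteq> {1..k} \<and> card A = j}"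
        using j by auto
      fix A assume "A \<in> {A. A \<subseteq> {1..k} \<and> card A = j}"
      then show "?F A = ?F {1..j}"
        using card_onto_colourings[OF G, of A] finite_subset[of A "{1..k}"] by auto
    qed
    also have "\<dots> = ?F {1..j} * (k choose j)"
      by (simp add: n_subsets)
    finally show "(\<Sum>A\<in>{A\<in>{A\<in>Pow {1..k}. card A \<le> ?n}. card A = j}. ?F A) =
          ?F {1..j} * (k choose j)" .
  qed
  finally show ?thesis .
qed

lemma chromatic_poly_ex1:
  assumes "two_edge_coloured G"
  shows "\<exists>!p::complex poly. \<forall>k::nat. poly p (of_nat k) = of_nat (card (colourings G k))"
proof (rule ex_ex1I)
  let ?p = "\<Sum>j\<le>card (verts G). smult (of_nat (card (onto_colourings G {1..j})) / fact j)
                (\<Prod>i = 0..<j. [:- of_nat i, 1:]) :: complex poly"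
  have "poly ?p (of_nat k) = of_nat (card (colourings G k))" for k
    unfolding card_colourings[OF assms]
    by (simp add: poly_sum poly_prod binomial_gbinomial gbinomial_prod_rev)
  then show "\<exists>p::complex poly. \<forall>k::nat. poly p (of_nat k) = of_nat (card (colourings G k))"
    by blast
qed (metis poly_eqI_nat)

lemma poly_chromatic_poly:
  assumes "two_edge_coloured G"
  shows "poly (chromatic_poly G) (of_nat k) = of_nat (card (colourings G k))"
  using theI'[OF chromatic_poly_ex1[OF assms]] unfolding chromatic_poly_def by blast

text \<open>Every finite graph is isomorphic to one whose vertices are natural numbers, so fixing
  the vertex type here loses no graphs up to isomorphism.\<close>

definition bichromatic_root :: "complex \<Rightarrow> bool" where
  "bichromatic_root z \<longleftrightarrow>
     (\<exists>G :: nat two_edge_coloured_graph. bichromatic G \<and> poly (chromatic_poly G) z = 0)"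

end

theory Submission
  imports Defs
begin

text \<open>Join the 4-cycle, whose chromatic polynomial \<open>x (x - 1) (x\<^sup>2 - 3 x + 3)\<close> has the non-real
  root \<open>(3 + \<i> \<surd>3) / 2\<close>, with a complete graph on \<open>m \<ge> 2\<close> vertices, and make one edge between two
  vertices of the complete graph blue and all other edges red. The colours of these two vertices
  occur nowhere else, so the colour condition on the edges is vacuous, and adding a dominating
  vertex shifts the roots of an ordinary chromatic polynomial by 1. Hence \<open>m + (3 + \<i> \<surd>3) / 2\<close> is a
  bichromatic root for every \<open>m \<ge> 2\<close>.\<close>

section \<open>Proper colourings and dominating vertices\<close>

text \<open>The colour set is arbitrary rather than \<open>{1..k}\<close>, because deleting the
  colour of a dominating vertex does not leave an initial segment.\<close>

definition proper_colourings :: "'a set \<Rightarrow> 'a set set \<Rightarrow> 'b set \<Rightarrow> ('a \<Rightarrow> 'b) set" where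
  "proper_colourings V E A = {c \<in> V \<rightarrow>\<^sub>E A. \<forall>u v. {u, v} \<in> E \<longrightarrow> c u \<noteq> c v}"

lemma finite_proper_colourings:
  "finite V \<Longrightarrow> finite A \<Longrightarrow> finite (proper_colourings V E A)"
  by (rule finite_subset[of _ "V \<rightarrow>\<^sub>E A"]) (auto simp: proper_colourings_def finite_PiE)

definition add_dominating :: "'a \<Rightarrow> 'a set \<Rightarrow> 'a set set \<Rightarrow> 'a set set" where
  "add_dominating w V E = E \<union> (\<lambda>v. {w, v}) ` V"

text \<open>Once \<open>w\<close> has colour \<open>a\<close>, all other vertices, being adjacent to
  \<open>w\<close>, must avoid \<open>a\<close>; their remaining constraints are those of
  \<open>E\<close>.\<close>

lemma card_proper_colourings_add_dominating:
  assumes V: "finite V" and A: "finite A" and w: "w \<notin> V" and E: "\<Union>E \<subseteq> V"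
  shows "card (proper_colourings (insert w V) (add_dominating w V E) A) =
    (\<Sum>a\<in>A. card (proper_colourings V E (A - {a})))"
proof -
  let ?S = "SIGMA a:A. proper_colourings V E (A - {a})"
  let ?T = "proper_colourings (insert w V) (add_dominating w V E) A"
  \<comment> \<open>Edges of \<open>E\<close> miss \<open>w\<close>, so neither restricting to
    \<open>V\<close> nor updating at \<open>w\<close> changes the colours of their ends.\<close>
  have E': "u \<in> V \<and> v \<in> V" if "{u, v} \<in> E" for u v using that E by auto
  have "bij_betw (\<lambda>c. (c w, restrict c V)) ?T ?S"
  proof (rule bij_betw_byWitness[where f' = "\<lambda>(a, c). c(w := a)"])
    show "\<forall>c\<in>?T. (case (c w, restrict c V) of (a, c) \<Rightarrow> c(w := a)) = c"
    proof
      fix c assume "c \<in> ?T"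
      then have "c \<in> extensional (insert w V)" by (auto simp: proper_colourings_def PiE_def)
      then show "(case (c w, restrict c V) of (a, c) \<Rightarrow> c(w := a)) = c"
        by (auto simp: extensional_def fun_eq_iff restrict_def)
    qed
    show "\<forall>p\<in>?S. ((case p of (a, c) \<Rightarrow> c(w := a)) w,
        restrict (case p of (a, c) \<Rightarrow> c(w := a)) V) = p"
    proof
      fix p assume "p \<in> ?S"
      then have "snd p \<in> extensional V" by (auto simp: proper_colourings_def PiE_def)
      then have "restrict ((snd p)(w := fst p)) V = snd p"
        using w by (auto simp: extensional_def fun_eq_iff restrict_def)
      then show "((case p of (a, c) \<Rightarrow> c(w := a)) w,
          restrict (case p of (a, c) \<Rightarrow> c(w := a)) V) = p"
        by (simp add: case_prod_unfold)
    qed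
    show "(\<lambda>c. (c w, restrict c V)) ` ?T \<subseteq> ?S"
    proof (rule image_subsetI)
      fix c assume c: "c \<in> ?T"
      then have p: "c u \<noteq> c v" if "{u, v} \<in> add_dominating w V E" for u v
        using that by (auto simp: proper_colourings_def)
      have "c v \<noteq> c w" if "v \<in> V" for v
        using p[of w v] that by (fastforce simp: add_dominating_def)
      moreover have "c u \<noteq> c v" if "{u, v} \<in> E" for u v
        using p that by (simp add: add_dominating_def)
      ultimately show "(c w, restrict c V) \<in> ?S"
        using c E' by (auto simp: proper_colourings_def PiE_def)
    qed
    show "(\<lambda>(a, c). c(w := a)) ` ?S \<subseteq> ?T"
    proof safe
      fix a c assume a: "a \<in> A" and c: "c \<in> proper_colourings V E (A - {a})"
      have av: "c v \<noteq> a" "c v \<in> A" if "v \<in> V" for v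
        using c that by (auto simp: proper_colourings_def)
      have "(c(w := a)) u \<noteq> (c(w := a)) v" if uv: "{u, v} \<in> add_dominating w V E" for u v
      proof -
        consider "{u, v} \<in> E" | "u = w" "v \<in> V" | "v = w" "u \<in> V"
          using uv by (auto simp: add_dominating_def doubleton_eq_iff)
        then show ?thesis
        proof cases
          case 1
          then have "c u \<noteq> c v" "u \<noteq> w" "v \<noteq> w"
            using c E'[OF 1] w by (auto simp: proper_colourings_def)
          then show ?thesis by simp
        next
          case 2
          then show ?thesis using av(1)[of v] w by auto
        next
          case 3
          then show ?thesis using av(1)[of u] w by auto
        qed
      qed
      moreover have "c(w := a) \<in> insert w V \<rightarrow>\<^sub>E A"
        using c a av by (auto simp: proper_colourings_def PiE_def extensional_def)
      ultimately show "c(w := a) \<in> ?T" by (simp add: proper_colourings_def)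
    qed
  qed
  then have "card ?T = card ?S" by (rule bij_betw_same_card)
  also have "\<dots> = (\<Sum>a\<in>A. card (proper_colourings V E (A - {a})))"
    using V A by (intro card_SigmaI) (auto intro: finite_proper_colourings)
  finally show ?thesis .
qed

section \<open>The chromatic polynomial of the 4-cycle\<close>

definition four_cycle :: "nat set set" where
  "four_cycle = {{0, 1}, {1, 2}, {2, 3}, {3, 0}}"

text \<open>Colour the opposite vertices 0 and 2 first; then 1 and 3 can be coloured independently.\<close>

lemma card_proper_colourings_four_cycle:
  assumes A: "finite A"
  shows "card (proper_colourings {..<4} four_cycle A) =
    (\<Sum>x\<in>A. \<Sum>y\<in>A. (card (A - {x, y}))\<^sup>2)"
proof -
  let ?T = "proper_colourings {..<4::nat} four_cycle A"
  \<comment> \<open>Here \<open>p\<close> holds the colours of 0 and 2, and \<open>?B p\<close> the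
    admissible colour pairs for 1 and 3. In \<open>?g\<close>, the inverse map, the final
    \<open>else\<close> is vertex 3.\<close>
  let ?B = "\<lambda>p. (A - {fst p, snd p}) \<times> (A - {fst p, snd p})"
  let ?g = "\<lambda>((x, y), (z, w)). (\<lambda>i\<in>{..<4::nat}. if i = 0 then x else if i = 2 then y
    else if i = 1 then z else w)"
  have l4: "i < 4 \<longleftrightarrow> i = 0 \<or> i = 1 \<or> i = 2 \<or> i = 3" for i :: nat by auto
  have "bij_betw (\<lambda>c. ((c 0, c 2), (c 1, c 3))) ?T (Sigma (A \<times> A) ?B)"
  proof (rule bij_betw_byWitness[where f' = ?g])
    show "\<forall>c\<in>?T. ?g ((c 0, c 2), (c 1, c 3)) = c"
      by (auto simp: proper_colourings_def PiE_def extensional_def fun_eq_iff l4)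
    show "\<forall>p\<in>Sigma (A \<times> A) ?B. ((?g p 0, ?g p 2), (?g p 1, ?g p 3)) = p" by auto
    show "(\<lambda>c. ((c 0, c 2), (c 1, c 3))) ` ?T \<subseteq> Sigma (A \<times> A) ?B"
    proof (rule image_subsetI)
      fix c assume "c \<in> ?T"
      then have "c i \<in> A" if "i < 4" for i using that by (auto simp: proper_colourings_def)
      moreover have "c 0 \<noteq> c 1" "c 1 \<noteq> c 2" "c 2 \<noteq> c 3" "c 3 \<noteq> c 0"
        using \<open>c \<in> ?T\<close> unfolding proper_colourings_def four_cycle_def by blast+
      ultimately show "((c 0, c 2), (c 1, c 3)) \<in> Sigma (A \<times> A) ?B" by auto
    qed
    show "?g ` Sigma (A \<times> A) ?B \<subseteq> ?T"
      by (auto simp: proper_colourings_def four_cycle_def doubleton_eq_iff split: if_splits)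
  qed
  then have "card ?T = card (Sigma (A \<times> A) ?B)" by (rule bij_betw_same_card)
  also have "\<dots> = (\<Sum>p\<in>A \<times> A. card (?B p))"
    using A by (intro card_SigmaI) auto
  also have "\<dots> = (\<Sum>x\<in>A. \<Sum>y\<in>A. (card (A - {x, y}))\<^sup>2)"
    by (simp add: sum.cartesian_product card_cartesian_product power2_eq_square case_prod_unfold)
  finally show ?thesis .
qed

text \<open>If vertices 0 and 2 share a colour, 1 and 3 have \<open>x - 1\<close> choices each,
  otherwise \<open>x - 2\<close>; this gives the factor
  \<open>(x - 1)\<^sup>2 + (x - 1) * (x - 2)\<^sup>2\<close> for each colour of vertex 0.\<close>

lemma four_cycle_polynomial:
  assumes A: "finite A"
  defines "x \<equiv> of_nat (card A) :: complex"
  shows "of_nat (card (proper_colourings {..<4} four_cycle A)) = x * (x - 1) * (x\<^sup>2 - 3 * x + 3)"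
proof -
  have inner: "of_nat (\<Sum>v\<in>A. (card (A - {u, v}))\<^sup>2) = (x - 1)\<^sup>2 + (x - 1) * (x - 2)\<^sup>2"
    if u: "u \<in> A" for u
  proof -
    \<comment> \<open>Cardinalities are compared through \<open>Suc\<close> and subtracted only in
      the complex numbers, which avoids truncated subtraction.\<close>
    have c1: "of_nat (card (A - {u})) = x - 1"
      using u A card_Suc_Diff1[OF A u] unfolding x_def by (metis add_diff_cancel_left' of_nat_Suc)
    have c2: "of_nat (card (A - {u, v})) = x - 2" if v: "v \<in> A - {u}" for v
    proof -
      have "Suc (card (A - {u} - {v})) = card (A - {u})"
        using card_Suc_Diff1[of "A - {u}" v] A v by simp
      moreover have "A - {u} - {v} = A - {u, v}" by auto
      ultimately have "1 + of_nat (card (A - {u, v})) = x - 1"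
        using c1 by (metis of_nat_Suc)
      then show ?thesis by (simp add: algebra_simps)
    qed
    \<comment> \<open>The term \<open>v = u\<close> is split off; there \<open>{u, v}\<close>
      collapses to \<open>{u}\<close>.\<close>
    have "of_nat (\<Sum>v\<in>A. (card (A - {u, v}))\<^sup>2) =
        (of_nat (card (A - {u})))\<^sup>2 + (\<Sum>v\<in>A - {u}. (of_nat (card (A - {u, v})))\<^sup>2 :: complex)"
      using A u by (simp add: sum.remove[of A u])
    also have "(\<Sum>v\<in>A - {u}. (of_nat (card (A - {u, v})))\<^sup>2 :: complex) = of_nat (card (A - {u})) * (x - 2)\<^sup>2"
      using c2 by simp
    finally show ?thesis by (simp only: c1)
  qed
  have "of_nat (card (proper_colourings {..<4} four_cycle A)) =
      (\<Sum>u\<in>A. of_nat (\<Sum>v\<in>A. (card (A - {u, v}))\<^sup>2) :: complex)"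
    by (simp add: card_proper_colourings_four_cycle[OF A])
  also have "\<dots> = x * ((x - 1)\<^sup>2 + (x - 1) * (x - 2)\<^sup>2)"
    by (simp only: inner sum_constant x_def cong: sum.cong)
  also have "\<dots> = x * (x - 1) * (x\<^sup>2 - 3 * x + 3)"
    by (simp add: algebra_simps power2_eq_square)
  finally show ?thesis .
qed

section \<open>Joining the 4-cycle with a complete graph\<close>

text \<open>Dominating vertices are added one at a time: 0 to 3 carry the cycle, and those from 4 to
  \<open>m + 3\<close> form the complete graph.\<close>

fun cycle_join_complete :: "nat \<Rightarrow> nat set set" where
  "cycle_join_complete 0 = four_cycle"
| "cycle_join_complete (Suc m) = add_dominating (m + 4) {..<m + 4} (cycle_join_complete m)"

lemma cycle_join_complete_edge:
  "e \<in> cycle_join_complete m \<Longrightarrow> e \<subseteq> {..<m + 4} \<and> card e = 2"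
proof (induction m)
  case 0
  then show ?case by (auto simp: four_cycle_def)
next
  case (Suc m)
  then consider "e \<in> cycle_join_complete m" | v where "e = {m + 4, v}" "v < m + 4"
    by (auto simp: add_dominating_def)
  then show ?case
  proof cases
    case 1
    then have "e \<subseteq> {..<m + 4} \<and> card e = 2" by (rule Suc.IH)
    then show ?thesis by auto
  next
    case 2
    then show ?thesis by auto
  qed
qed

text \<open>The newest vertex is adjacent to all earlier ones, so a vertex \<open>w\<close> from 4
  on meets the older vertices when it is added and the newer ones when they are. For
  \<open>m = 0\<close> no such \<open>w\<close> exists.\<close>

lemma cycle_join_complete_dominating:
  "u < m + 4 \<Longrightarrow> w < m + 4 \<Longrightarrow> 4 \<le> w \<Longrightarrow> u \<noteq> w \<Longrightarrow> {u, w} \<in> cycle_join_complete m"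
proof (induction m)
  case (Suc m)
  consider "u < m + 4" "w < m + 4" | "w = m + 4" "u < m + 4" | "u = m + 4" "w < m + 4"
    using Suc.prems by linarith
  then show ?case
  proof cases
    case 1
    then show ?thesis using Suc.IH Suc.prems by (simp add: add_dominating_def)
  next
    case 2
    then show ?thesis by (simp add: add_dominating_def image_iff doubleton_eq_iff)
  next
    case 3
    then show ?thesis by (simp add: add_dominating_def)
  qed
qed simp

text \<open>Each dominating vertex turns a counting polynomial \<open>p(x)\<close> into
  \<open>x * p(x - 1)\<close>; after \<open>m\<close> rounds this is a falling factorial times the
  4-cycle polynomial at \<open>x - m\<close>. The induction varies \<open>A\<close> since the
  recurrence passes to \<open>A - {a}\<close>.\<close>

lemma card_proper_colourings_cycle_join_complete:
  fixes m :: nat and A :: "'b set"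
  assumes "finite A"
  defines "x \<equiv> of_nat (card A) :: complex"
  shows "of_nat (card (proper_colourings {..<m + 4} (cycle_join_complete m) A)) =
    (\<Prod>i<m. x - of_nat i) *
    ((x - of_nat m) * (x - of_nat m - 1) * ((x - of_nat m)\<^sup>2 - 3 * (x - of_nat m) + 3))"
  using assms(1) unfolding x_def
proof (induction m arbitrary: A)
  case 0
  then show ?case by (simp add: four_cycle_polynomial)
next
  case (Suc m)
  let ?q = "\<lambda>t::complex. t * (t - 1) * (t\<^sup>2 - 3 * t + 3)"
  let ?x = "of_nat (card A) :: complex"
  have "\<Union>(cycle_join_complete m) \<subseteq> {..<m + 4}"
    using cycle_join_complete_edge by auto
  moreover have "{..<Suc m + 4} = insert (m + 4) {..<m + 4}" by auto
  ultimately have "of_nat (card (proper_colourings {..<Suc m + 4} (cycle_join_complete (Suc m)) A)) =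
      (\<Sum>a\<in>A. of_nat (card (proper_colourings {..<m + 4} (cycle_join_complete m) (A - {a})))
        :: complex)"
    using card_proper_colourings_add_dominating[of "{..<m + 4}" A "m + 4" "cycle_join_complete m"]
      Suc.prems by simp
  also have "\<dots> = (\<Sum>a\<in>A. (\<Prod>i<m. ?x - 1 - of_nat i) * ?q (?x - 1 - of_nat m))"
  proof (rule sum.cong[OF refl])
    fix a assume "a \<in> A"
    then have "Suc (card (A - {a})) = card A" using Suc.prems by (intro card_Suc_Diff1)
    then have "of_nat (card (A - {a})) = ?x - 1" by (metis add_diff_cancel_left' of_nat_Suc)
    then show "of_nat (card (proper_colourings {..<m + 4} (cycle_join_complete m) (A - {a}))) =
        (\<Prod>i<m. ?x - 1 - of_nat i) * ?q (?x - 1 - of_nat m)"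
      using Suc.IH[of "A - {a}"] Suc.prems by simp
  qed
  \<comment> \<open>The summand is independent of \<open>a\<close>, so the sum contributes a factor
    \<open>?x\<close>. It becomes the term \<open>i = 0\<close>, and the other indices shift by
    one.\<close>
  also have "\<dots> = (\<Prod>i<Suc m. ?x - of_nat i) * ?q (?x - of_nat (Suc m))"
    by (simp add: prod.lessThan_Suc_shift diff_diff_eq del: prod.lessThan_Suc)
  finally show ?case .
qed

section \<open>The 2-edge-coloured graph and its polynomial\<close>

text \<open>Vertices 4 and 5 are the first two of the complete graph; both are present exactly when
  \<open>m \<ge> 2\<close>.\<close>

definition cycle_join_graph :: "nat \<Rightarrow> nat two_edge_coloured_graph" where
  "cycle_join_graph m = \<lparr>verts = {..<m + 4}, edges = cycle_join_complete m,
     red = cycle_join_complete m - {{4, 5}}, blue = {{4, 5}}\<rparr>"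

lemma bichromatic_cycle_join_graph:
  assumes "m \<ge> 2"
  shows "bichromatic (cycle_join_graph m)"
proof -
  have blue: "{4, 5} \<in> cycle_join_complete m" and "{0, 4} \<in> cycle_join_complete m"
    using assms by (auto intro!: cycle_join_complete_dominating)
  moreover have "{0, 4} \<noteq> {4, 5::nat}" by (auto simp: doubleton_eq_iff)
  ultimately have "cycle_join_complete m - {{4, 5}} \<noteq> {}" by (metis DiffI empty_iff singletonD)
  moreover have "\<forall>e\<in>cycle_join_complete m. e \<subseteq> {..<m + 4} \<and> card e = 2"
    using cycle_join_complete_edge by blast
  ultimately show ?thesis
    unfolding bichromatic_def two_edge_coloured_def cycle_join_graph_def
    using blue by (simp add: insert_absorb)
qed

lemma colourings_cycle_join_graph:
  assumes m: "m \<ge> 2"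
  shows "colourings (cycle_join_graph m) k =
    proper_colourings {..<m + 4} (cycle_join_complete m) {1..k}"
proof -
  have distinct: "c x \<noteq> c y"
    if c: "c \<in> proper_colourings {..<m + 4} (cycle_join_complete m) {1..k}"
      and r: "{u, x} \<in> cycle_join_complete m - {{4, 5}}" and b: "{v, y} \<in> {{4, 5}}"
      and uv: "c u = c v" for c u x v y
  proof
    assume xy: "c x = c y"
    \<comment> \<open>A dominating vertex \<open>w\<close> is adjacent to every other vertex, so its
      colour determines it.\<close>
    have unique: "i = w" if "i < m + 4" "4 \<le> w" "w < m + 4" "c i = c w" for i w
      using c that cycle_join_complete_dominating[of i m w]
      by (auto simp: proper_colourings_def)
    have "u < m + 4" "x < m + 4" using cycle_join_complete_edge[of "{u, x}"] r by auto
    moreover have "4 \<le> v" "v < m + 4" "4 \<le> y" "y < m + 4"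
      using b m by (auto simp: doubleton_eq_iff)
    \<comment> \<open>Both ends of the blue edge are dominating, so a violating red edge would be
      the blue edge itself.\<close>
    ultimately have "u = v" "x = y" using unique uv xy by blast+
    with r b show False by simp
  qed
  show ?thesis
  proof (intro equalityI subsetI)
    fix c assume "c \<in> colourings (cycle_join_graph m) k"
    then show "c \<in> proper_colourings {..<m + 4} (cycle_join_complete m) {1..k}"
      by (simp add: colourings_def cycle_join_graph_def proper_colourings_def)
  next
    fix c assume c: "c \<in> proper_colourings {..<m + 4} (cycle_join_complete m) {1..k}"
    then have "c \<in> {..<m + 4} \<rightarrow>\<^sub>E {1..k}" "\<forall>u v. {u, v} \<in> cycle_join_complete m \<longrightarrow> c u \<noteq> c v"
      by (simp_all add: proper_colourings_def)
    then show "c \<in> colourings (cycle_join_graph m) k"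
      using distinct[OF c] unfolding colourings_def cycle_join_graph_def by simp
  qed
qed

text \<open>Counting with \<open>{1..k}\<close> gives the values at natural numbers only; these
  determine the polynomial, so the factorisation extends to every complex \<open>z\<close>.\<close>

lemma poly_chromatic_poly_cycle_join_graph:
  fixes z :: complex
  assumes m: "m \<ge> 2"
  shows "poly (chromatic_poly (cycle_join_graph m)) z = (\<Prod>i<m. z - of_nat i) *
    ((z - of_nat m) * (z - of_nat m - 1) * ((z - of_nat m)\<^sup>2 - 3 * (z - of_nat m) + 3))"
proof -
  let ?t = "[:- of_nat m, 1:] :: complex poly"
  let ?p = "(\<Prod>i<m. [:- of_nat i, 1:]) * (?t * (?t - 1) * (?t\<^sup>2 - 3 * ?t + 3)) :: complex poly"
  have eval: "poly ?p w = (\<Prod>i<m. w - of_nat i) *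
      ((w - of_nat m) * (w - of_nat m - 1) * ((w - of_nat m)\<^sup>2 - 3 * (w - of_nat m) + 3))" for w
  proof -
    have "poly [:- a, 1:] w = w - a" for a by simp
    then show ?thesis
      by (simp only: poly_mult poly_prod poly_diff poly_add poly_power poly_numeral poly_1)
  qed
  have "two_edge_coloured (cycle_join_graph m)"
    using bichromatic_cycle_join_graph[OF m] by (simp add: bichromatic_def)
  then have "poly (chromatic_poly (cycle_join_graph m)) (of_nat k) = poly ?p (of_nat k)" for k
    using card_proper_colourings_cycle_join_complete[of "{1..k}" m]
    by (simp only: poly_chromatic_poly colourings_cycle_join_graph[OF m] eval
        finite_atLeastAtMost card_atLeastAtMost diff_Suc_1)
  then have "chromatic_poly (cycle_join_graph m) = ?p" by (rule poly_eqI_nat)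
  then show ?thesis by (simp only: eval)
qed

section \<open>Non-real roots of large modulus\<close>

theorem theorem18:
  "\<forall>M::real. M > 0 \<longrightarrow> (\<exists>z::complex. bichromatic_root z \<and> z \<notin> \<real> \<and> norm z > M)"
proof (intro allI impI)
  fix M :: real
  obtain n :: nat where n: "M < real n" using reals_Archimedean2 by blast
  \<comment> \<open>The summand 2 secures \<open>m \<ge> 2\<close>, so that the blue edge
    exists.\<close>
  define m where "m = n + 2"
  define r where "r = Complex (3 / 2) (sqrt 3 / 2)"
  have "r\<^sup>2 - 3 * r + 3 = 0"
    by (simp add: r_def complex_eq_iff power2_eq_square)
  then have "poly (chromatic_poly (cycle_join_graph m)) (of_nat m + r) = 0"
    by (subst poly_chromatic_poly_cycle_join_graph) (simp_all add: m_def)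
  moreover have "bichromatic (cycle_join_graph m)"
    by (rule bichromatic_cycle_join_graph) (simp add: m_def)
  ultimately have "bichromatic_root (of_nat m + r)"
    unfolding bichromatic_root_def by blast
  moreover have "of_nat m + r \<notin> \<real>"
    by (simp add: complex_is_Real_iff r_def)
  \<comment> \<open>The modulus is at least the real part, which is
    \<open>n + 7 / 2\<close>.\<close>
  moreover have "norm (of_nat m + r) > M"
    using n complex_Re_le_cmod[of "of_nat m + r"] by (simp add: m_def r_def)
  ultimately show "\<exists>z. bichromatic_root z \<and> z \<notin> \<real> \<and> norm z > M" by blast
qed

end
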